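(* Let $\alpha:\mathbb{R}\to(0,\infty)$ be strictly increasing, let $(\xi_t)_{t\ge 0}$ be i.i.d. with $\Pr(\xi_t=1)=\Pr(\xi_t=-1)=\tfrac12$, let $u\in\mathbb{R}$, and define $X_0=u$ (deterministic) and $X_{t+1}=X_t+\xi_t\,\alpha(X_t)$ for $t\ge 0$. Put $F_t(x)=\Pr(X_t\le x)$. Then for all $t\ge 1$, $$F_t(u)\ \ge\ \tfrac12,$$ with strict inequality $F_t(u)>\tfrac12$ whenever $t$ is even. Hence, for every even $t\ge 2$, every median $m_t$ of $X_t$ satisfies $m_t<u$.
   Context: A median of a real random variable $Y$ is any $m\in\mathbb{R}$ with $\Pr(Y\le m)\ge\tfrac12$ and $\Pr(Y\ge m)\ge\tfrac12$. *)

theory Defs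
  imports "HOL-Probability.Probability"
begin

definition is_median :: "'a measure \<Rightarrow> ('a \<Rightarrow> real) \<Rightarrow> real \<Rightarrow> bool" where
  "is_median M Y m \<longleftrightarrow>
     \<P>(\<omega> in M. Y \<omega> \<le> m) \<ge> 1 / 2 \<and> \<P>(\<omega> in M. Y \<omega> \<ge> m) \<ge> 1 / 2"

primrec walk :: "(real \<Rightarrow> real) \<Rightarrow> real \<Rightarrow> (nat \<Rightarrow> 'a \<Rightarrow> real) \<Rightarrow> nat \<Rightarrow> 'a \<Rightarrow> real" where
  "walk \<alpha> u \<xi> 0 \<omega> = u"
| "walk \<alpha> u \<xi> (Suc t) \<omega> = walk \<alpha> u \<xi> t \<omega> + \<xi> t \<omega> * \<alpha> (walk \<alpha> u \<xi> t \<omega>)"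

end

theory Submission
  imports Defs
begin

text \<open>
  Compare \<open>X\<close> with the simple random walk \<open>S t = (\<Sum>i<t. \<xi> i)\<close>. Since \<open>\<alpha>\<close> increases, every excursion of
  \<open>S\<close> away from a level costs \<open>X\<close> something: an up-step is undone by a larger down-step, and a
  down-step is only partly undone by an up-step. Hence \<open>X t < u\<close> on the event \<open>S t \<le> 0\<close> for
  \<open>t \<ge> 1\<close>. By symmetry of \<open>S\<close> that event has probability at least \<open>1/2\<close>, and more if \<open>t\<close> is even
  because then \<open>S t = 0\<close> has positive probability.
\<close>

text \<open>A discrete crossing argument, applied to a path and to its negative, so it yields both
  down- and up-crossings. No step size is assumed here; with unit steps on the integers the two
  inequalities pin \<open>s k\<close> to exactly \<open>c\<close>.\<close>

lemma last_step_below: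
  fixes s :: "nat \<Rightarrow> int"
  assumes "i < j" "c \<le> s i" "s j < c"
  shows "\<exists>k\<ge>i. k < j \<and> c \<le> s k \<and> s (Suc k) < c"
  using assms
proof (induction j)
  case (Suc j)
  show ?case
  proof (cases "c \<le> s j")
    case True
    then show ?thesis using Suc.prems by (intro exI[of _ j]) auto
  next
    case False
    then have "i < j" using Suc.prems by (metis less_antisym)
    then show ?thesis using Suc False by (meson less_Suc_eq not_le)
  qed
qed simp

text \<open>Strong induction on the end time \<open>j\<close>, splitting on the direction of the
  final step. The start \<open>i\<close> stays arbitrary because the argument also compares
  intermediate times around a crossing, not only times with the origin.\<close>

lemma driven_path_less:
  fixes \<alpha> :: "real \<Rightarrow> real" and x :: "nat \<Rightarrow> real" and s :: "nat \<Rightarrow> int"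
  assumes \<alpha>: "\<And>y. \<alpha> y > 0" "strict_mono \<alpha>"
    and s: "\<And>n. s (Suc n) = s n + 1 \<or> s (Suc n) = s n - 1"
    and x: "\<And>n. x (Suc n) = x n + of_int (s (Suc n) - s n) * \<alpha> (x n)"
    and "i < j" "s j \<le> s i"
  shows "x j < x i"
  using \<open>i < j\<close> \<open>s j \<le> s i\<close>
proof (induction j arbitrary: i rule: less_induct)
  case (less j)
  obtain n where n: "j = Suc n" "i \<le> n" using less.prems by (cases j) auto
  \<comment> \<open>The weak form covers equal times: the crossing time \<open>k\<close> found below
    may be \<open>i\<close> itself, and \<open>Suc k\<close> may be \<open>n\<close>.\<close>
  have le: "x k \<le> x l" if "l \<le> k" "k \<le> n" "s k \<le> s l" for k l
    using less.IH[of k l] that n by (cases "l = k") auto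
  show ?case
  proof (cases "s (Suc n) = s n + 1")
    case True
    then have "s n < s i" using less.prems n by simp
    then have "i < n" using n by (metis le_neq_implies_less less_irrefl)
    \<comment> \<open>The final up-step is paired with an earlier down-step from level
      \<open>s i\<close>. As \<open>s n \<le> s (Suc k)\<close>, the up-step starts no higher than
      \<open>x (Suc k)\<close>, which is below \<open>x k\<close>, so it gains less than the
      down-step cost.\<close>
    then obtain k where k: "i \<le> k" "k < n" "s i \<le> s k" "s (Suc k) < s i"
      using last_step_below[of i n "s i" s] \<open>s n < s i\<close> by auto
    then have sk: "s k = s i" "s (Suc k) = s k - 1" using s[of k] by auto
    have xk: "x k \<le> x i" using le[of i k] k sk by simp
    have xk1: "x (Suc k) = x k - \<alpha> (x k)" using x[of k] sk by simp
    have xn: "x n \<le> x (Suc k)" using le[of "Suc k" n] k sk \<open>s n < s i\<close> by simp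
    have "\<alpha> (x n) \<le> \<alpha> (x (Suc k))"
      using xn \<alpha>(2) by (simp add: strict_mono_less_eq)
    moreover have "\<alpha> (x (Suc k)) < \<alpha> (x k)"
      using xk1 \<alpha> by (simp add: strict_mono_less)
    moreover have "x j = x n + \<alpha> (x n)" using x[of n] n True by simp
    ultimately show ?thesis using xk xk1 xn by linarith
  next
    case False
    then have sn: "s (Suc n) = s n - 1" using s[of n] by auto
    then have xj: "x j = x n - \<alpha> (x n)" using x[of n] n by simp
    show ?thesis
    proof (cases "s n \<le> s i")
      case True
      then show ?thesis using le[of i n] n xj \<alpha>(1)[of "x n"] by simp
    next
      case False
      then have sni: "s n = s i + 1" using sn less.prems n by simp
      then have "i < n" using n by (metis le_neq_implies_less False order_refl)
      \<comment> \<open>The mirror image: the final down-step is paired with an earlier up-step from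
        level \<open>s i\<close>, and \<open>s n = s (Suc k)\<close> bounds \<open>x n\<close> by
        the height reached after that up-step.\<close>
      then obtain k where k: "i \<le> k" "k < n" "- s i \<le> - s k" "- s (Suc k) < - s i"
        using last_step_below[of i n "- s i" "\<lambda>m. - s m"] sni by auto
      then have sk: "s k = s i" "s (Suc k) = s k + 1" using s[of k] by auto
      have xk: "x k \<le> x i" using le[of i k] k sk by simp
      have "x (Suc k) = x k + \<alpha> (x k)" using x[of k] sk by simp
      then have xn: "x n \<le> x k + \<alpha> (x k)" using le[of "Suc k" n] k sk sni by simp
      \<comment> \<open>If \<open>x n\<close> has already fallen to \<open>x k\<close>, any further
        down-step suffices. Otherwise the down-step starts above \<open>x k\<close>, hence is longer
        than the up-step taken there.\<close>
      show ?thesis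
      proof (cases "x n \<le> x k")
        case True
        then show ?thesis using xj xk \<alpha>(1)[of "x n"] by linarith
      next
        case False
        then have "\<alpha> (x k) < \<alpha> (x n)" using \<alpha>(2) by (simp add: strict_mono_less)
        then show ?thesis using xj xk xn by linarith
      qed
    qed
  qed
qed

lemma walk_less_start:
  fixes \<alpha> :: "real \<Rightarrow> real" and \<xi> :: "nat \<Rightarrow> 'a \<Rightarrow> real"
  assumes \<alpha>: "\<And>y. \<alpha> y > 0" "strict_mono \<alpha>"
    and \<xi>: "\<And>i. \<xi> i \<omega> = 1 \<or> \<xi> i \<omega> = -1"
    and t: "t > 0" "(\<Sum>i<t. \<xi> i \<omega>) \<le> 0"
  shows "walk \<alpha> u \<xi> t \<omega> < u"
proof -
  \<comment> \<open>An integer copy of the signs: the crossing argument relies on there being no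
    level strictly between \<open>c - 1\<close> and \<open>c\<close>.\<close>
  define e :: "nat \<Rightarrow> int" where "e i = (if \<xi> i \<omega> = 1 then 1 else -1)" for i
  define s where "s n = (\<Sum>i<n. e i)" for n
  have e: "\<xi> i \<omega> = of_int (e i)" for i using \<xi>[of i] by (auto simp: e_def)
  have "(\<Sum>i<t. \<xi> i \<omega>) = of_int (s t)" by (simp add: e s_def)
  then have "s t \<le> 0" using t(2) by (metis of_int_le_0_iff)
  then have "s t \<le> s 0" by (simp add: s_def)
  moreover have "s (Suc n) = s n + 1 \<or> s (Suc n) = s n - 1" for n by (simp add: s_def e_def)
  moreover have "walk \<alpha> u \<xi> (Suc n) \<omega> = walk \<alpha> u \<xi> n \<omega>
      + of_int (s (Suc n) - s n) * \<alpha> (walk \<alpha> u \<xi> n \<omega>)" for n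
    by (simp add: s_def e)
  ultimately have "walk \<alpha> u \<xi> t \<omega> < walk \<alpha> u \<xi> 0 \<omega>"
    using driven_path_less[OF \<alpha>, where s = s and x = "\<lambda>n. walk \<alpha> u \<xi> n \<omega>" and i = 0 and j = t] t(1)
    by blast
  then show ?thesis by simp
qed

locale fair_signs = prob_space +
  fixes \<xi> :: "nat \<Rightarrow> 'a \<Rightarrow> real"
  assumes indep: "indep_vars (\<lambda>_. borel) \<xi> UNIV"
    and prob_1: "\<And>t. \<P>(\<omega> in M. \<xi> t \<omega> = 1) = 1 / 2"
    and prob_m1: "\<And>t. \<P>(\<omega> in M. \<xi> t \<omega> = -1) = 1 / 2"
begin

definition S :: "nat \<Rightarrow> 'a \<Rightarrow> real" where "S t \<omega> = (\<Sum>i<t. \<xi> i \<omega>)"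

lemma xi_measurable [measurable]: "\<xi> t \<in> borel_measurable M"
  using indep by (auto simp: indep_vars_def)

lemma S_measurable [measurable]: "S t \<in> borel_measurable M"
  unfolding S_def by measurable

lemma AE_sign: "AE \<omega> in M. \<xi> t \<omega> = 1 \<or> \<xi> t \<omega> = -1"
proof -
  have "\<P>(\<omega> in M. \<xi> t \<omega> = 1 \<or> \<xi> t \<omega> = -1)
      = prob ({\<omega>\<in>space M. \<xi> t \<omega> = 1} \<union> {\<omega>\<in>space M. \<xi> t \<omega> = -1})"
    by (rule arg_cong[where f = prob]) auto
  also have "\<dots> = \<P>(\<omega> in M. \<xi> t \<omega> = 1) + \<P>(\<omega> in M. \<xi> t \<omega> = -1)"
    by (rule finite_measure_Union) auto
  also have "\<dots> = 1" by (simp add: prob_1 prob_m1)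
  finally show ?thesis by (simp add: prob_Collect_eq_1)
qed

text \<open>Condition on the last sign, which is independent of \<open>S t\<close>. Symmetry and the
  positive mass at the parity value both follow by induction from this recursion.\<close>

lemma prob_S_Suc:
  assumes [measurable]: "Measurable.pred borel Q"
  shows "\<P>(\<omega> in M. Q (S (Suc t) \<omega>))
    = (\<P>(\<omega> in M. Q (S t \<omega> + 1)) + \<P>(\<omega> in M. Q (S t \<omega> - 1))) / 2"
proof -
  have "indep_vars (\<lambda>_. borel) \<xi> (insert t {..<t})"
    using indep by (rule indep_vars_subset) simp
  then have ind: "indep_var borel (\<xi> t) borel (S t)"
    unfolding S_def by (intro indep_vars_sum) auto
  have half: "\<P>(\<omega> in M. \<xi> t \<omega> = a \<and> Q (S t \<omega> + a)) = 1 / 2 * \<P>(\<omega> in M. Q (S t \<omega> + a))"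
    if "\<P>(\<omega> in M. \<xi> t \<omega> = a) = 1 / 2" for a
  proof -
    have "prob ((\<lambda>\<omega>. (\<xi> t \<omega>, S t \<omega>)) -` ({a} \<times> {y. Q (y + a)}) \<inter> space M)
      = prob (\<xi> t -` {a} \<inter> space M) * prob (S t -` {y. Q (y + a)} \<inter> space M)"
      using ind by (rule indep_varD) auto
    moreover have "(\<lambda>\<omega>. (\<xi> t \<omega>, S t \<omega>)) -` ({a} \<times> {y. Q (y + a)}) \<inter> space M
        = {\<omega>\<in>space M. \<xi> t \<omega> = a \<and> Q (S t \<omega> + a)}"
      "\<xi> t -` {a} \<inter> space M = {\<omega>\<in>space M. \<xi> t \<omega> = a}"
      "S t -` {y. Q (y + a)} \<inter> space M = {\<omega>\<in>space M. Q (S t \<omega> + a)}"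
      by auto
    ultimately show ?thesis using that by simp
  qed
  have "\<P>(\<omega> in M. Q (S (Suc t) \<omega>)) = prob ({\<omega>\<in>space M. \<xi> t \<omega> = 1 \<and> Q (S t \<omega> + 1)}
      \<union> {\<omega>\<in>space M. \<xi> t \<omega> = -1 \<and> Q (S t \<omega> + -1)})"
    \<comment> \<open>The two events agree only almost surely, since the signs may take other values
      on a null set.\<close>
    by (rule finite_measure_eq_AE) (use AE_sign[of t] in \<open>auto simp: S_def elim!: eventually_mono\<close>)
  also have "\<dots> = \<P>(\<omega> in M. \<xi> t \<omega> = 1 \<and> Q (S t \<omega> + 1)) + \<P>(\<omega> in M. \<xi> t \<omega> = -1 \<and> Q (S t \<omega> + -1))"
    by (rule finite_measure_Union) auto
  finally show ?thesis using half[OF prob_1] half[OF prob_m1] by simp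
qed

text \<open>Negation swaps the two halves of the recursion. \<open>Q\<close> is arbitrary in the
  induction because the hypothesis is applied to its translates by 1 and -1.\<close>

lemma S_symmetric:
  assumes "Measurable.pred borel Q"
  shows "\<P>(\<omega> in M. Q (S t \<omega>)) = \<P>(\<omega> in M. Q (- S t \<omega>))"
  using assms
proof (induction t arbitrary: Q)
  case 0
  then show ?case by (simp add: S_def)
next
  case (Suc t)
  note [measurable] = Suc.prems
  have "\<P>(\<omega> in M. Q (S t \<omega> + 1)) = \<P>(\<omega> in M. Q (- S t \<omega> + 1))"
    "\<P>(\<omega> in M. Q (S t \<omega> - 1)) = \<P>(\<omega> in M. Q (- S t \<omega> - 1))"
    by (rule Suc.IH, measurable)+
  moreover have "\<P>(\<omega> in M. Q (- S (Suc t) \<omega>))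
      = (\<P>(\<omega> in M. Q (- (S t \<omega> + 1))) + \<P>(\<omega> in M. Q (- (S t \<omega> - 1)))) / 2"
    by (rule prob_S_Suc) measurable
  moreover have neg: "- (y + 1) = - y - 1" "- (y - 1) = - y + 1" for y :: real by simp_all
  ultimately show ?case using prob_S_Suc[OF Suc.prems, of t] unfolding neg by argo
qed

text \<open>Even times are the goal; the odd case carries the induction through single steps,
  following the path that alternates between 0 and 1.\<close>

lemma prob_S_parity_pos: "\<P>(\<omega> in M. S t \<omega> = (if even t then 0 else 1)) > 0"
proof (induction t)
  case 0
  then show ?case by (simp add: S_def prob_space)
next
  case (Suc t)
  show ?case
  proof (cases "even t")
    case True
    have "\<P>(\<omega> in M. S (Suc t) \<omega> = 1) = (\<P>(\<omega> in M. S t \<omega> + 1 = 1) + \<P>(\<omega> in M. S t \<omega> - 1 = 1)) / 2"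
      by (rule prob_S_Suc) measurable
    moreover have "\<P>(\<omega> in M. S t \<omega> + 1 = 1) > 0" using Suc True by simp
    moreover have "\<P>(\<omega> in M. S t \<omega> - 1 = 1) \<ge> 0" by simp
    ultimately have "\<P>(\<omega> in M. S (Suc t) \<omega> = 1) > 0" by argo
    then show ?thesis using True by simp
  next
    case False
    have "\<P>(\<omega> in M. S (Suc t) \<omega> = 0) = (\<P>(\<omega> in M. S t \<omega> + 1 = 0) + \<P>(\<omega> in M. S t \<omega> - 1 = 0)) / 2"
      by (rule prob_S_Suc) measurable
    moreover have "\<P>(\<omega> in M. S t \<omega> - 1 = 0) > 0" using Suc False by simp
    moreover have "\<P>(\<omega> in M. S t \<omega> + 1 = 0) \<ge> 0" by simp
    ultimately have "\<P>(\<omega> in M. S (Suc t) \<omega> = 0) > 0" by argo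
    then show ?thesis using False by simp
  qed
qed

lemma prob_S_pos: "\<P>(\<omega> in M. S t \<omega> > 0) = (1 - \<P>(\<omega> in M. S t \<omega> = 0)) / 2"
proof -
  have "{\<omega>\<in>space M. S t \<omega> > 0} \<union> {\<omega>\<in>space M. S t \<omega> < 0} = space M - {\<omega>\<in>space M. S t \<omega> = 0}"
    by auto
  moreover have "prob ({\<omega>\<in>space M. S t \<omega> > 0} \<union> {\<omega>\<in>space M. S t \<omega> < 0})
      = \<P>(\<omega> in M. S t \<omega> > 0) + \<P>(\<omega> in M. S t \<omega> < 0)"
    by (rule finite_measure_Union) auto
  moreover have "\<P>(\<omega> in M. S t \<omega> > 0) = \<P>(\<omega> in M. S t \<omega> < 0)"
    using S_symmetric[of "\<lambda>y. y > 0" t] by simp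
  ultimately show ?thesis by (simp add: prob_compl)
qed

text \<open>The contrapositive of the pathwise comparison. Bounding the event
  \<open>\<ge> u\<close>, rather than the distribution function, serves both the bound on
  \<open>F t u\<close> and the claim on medians.\<close>

lemma prob_walk_ge_start:
  assumes "\<And>x. \<alpha> x > 0" "strict_mono \<alpha>" "t > 0"
  shows "\<P>(\<omega> in M. walk \<alpha> u \<xi> t \<omega> \<ge> u) \<le> \<P>(\<omega> in M. S t \<omega> > 0)"
proof (rule finite_measure_mono_AE)
  \<comment> \<open>Countably many null sets are discarded at once, since the pathwise lemma needs
    every sign along the path.\<close>
  have "AE \<omega> in M. \<forall>i. \<xi> i \<omega> = 1 \<or> \<xi> i \<omega> = -1" by (simp add: AE_all_countable AE_sign)
  then show "AE \<omega> in M. \<omega> \<in> {\<omega>\<in>space M. walk \<alpha> u \<xi> t \<omega> \<ge> u} \<longrightarrow> \<omega> \<in> {\<omega>\<in>space M. S t \<omega> > 0}"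
  proof eventually_elim
    case (elim \<omega>)
    then show ?case
      using walk_less_start[of \<alpha> \<xi> \<omega> t u] assms by (fastforce simp: S_def)
  qed
qed measurable

lemma walk_measurable:
  assumes "strict_mono \<alpha>"
  shows "walk \<alpha> u \<xi> t \<in> borel_measurable M"
proof -
  have [measurable]: "\<alpha> \<in> borel_measurable borel"
    using assms by (intro borel_measurable_mono strict_mono_mono)
  have "(\<lambda>\<omega>. walk \<alpha> u \<xi> t \<omega>) \<in> borel_measurable M"
    by (induction t) simp_all
  then show ?thesis by simp
qed

end

theorem theorem5p4:
  fixes M :: "'a measure" and \<alpha> :: "real \<Rightarrow> real" and \<xi> :: "nat \<Rightarrow> 'a \<Rightarrow> real" and u :: real
  assumes "prob_space M"
    and "\<And>x. \<alpha> x > 0"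
    and "strict_mono \<alpha>"
    and "prob_space.indep_vars M (\<lambda>_. borel) \<xi> UNIV"
    and "\<And>t. \<P>(\<omega> in M. \<xi> t \<omega> = 1) = 1 / 2"
    and "\<And>t. \<P>(\<omega> in M. \<xi> t \<omega> = -1) = 1 / 2"
  shows "(\<forall>t\<ge>1. \<P>(\<omega> in M. walk \<alpha> u \<xi> t \<omega> \<le> u) \<ge> 1 / 2 \<and>
                 (even t \<longrightarrow> \<P>(\<omega> in M. walk \<alpha> u \<xi> t \<omega> \<le> u) > 1 / 2)) \<and>
         (\<forall>t\<ge>2. even t \<longrightarrow> (\<forall>m. is_median M (walk \<alpha> u \<xi> t) m \<longrightarrow> m < u))"
proof -
  interpret fair_signs M \<xi>
    using assms by (intro fair_signs.intro fair_signs_axioms.intro)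
  have [measurable]: "walk \<alpha> u \<xi> t \<in> borel_measurable M" for t
    using assms(3) by (rule walk_measurable)
  have le: "\<P>(\<omega> in M. walk \<alpha> u \<xi> t \<omega> \<ge> u) \<le> (1 - \<P>(\<omega> in M. S t \<omega> = 0)) / 2" if "t \<ge> 1" for t
    using prob_walk_ge_start[OF assms(2,3), of t u] prob_S_pos[of t] that by simp
  have ge: "\<P>(\<omega> in M. walk \<alpha> u \<xi> t \<omega> \<ge> u) \<le> 1 / 2" if "t \<ge> 1" for t
    using le[OF that] measure_nonneg[of M "{\<omega>\<in>space M. S t \<omega> = 0}"] by argo
  \<comment> \<open>Strictness comes from the positive mass of \<open>S t\<close> at 0, which exists
    because \<open>t\<close> is even.\<close>
  have ge_even: "\<P>(\<omega> in M. walk \<alpha> u \<xi> t \<omega> \<ge> u) < 1 / 2" if "t \<ge> 1" "even t" for t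
    using le[OF that(1)] prob_S_parity_pos[of t] that(2) by simp
  have compl: "1 - \<P>(\<omega> in M. walk \<alpha> u \<xi> t \<omega> \<ge> u) \<le> \<P>(\<omega> in M. walk \<alpha> u \<xi> t \<omega> \<le> u)" for t
  proof -
    have "1 - \<P>(\<omega> in M. walk \<alpha> u \<xi> t \<omega> \<ge> u) = prob (space M - {\<omega>\<in>space M. walk \<alpha> u \<xi> t \<omega> \<ge> u})"
      by (rule prob_compl[symmetric]) measurable
    also have "\<dots> \<le> \<P>(\<omega> in M. walk \<alpha> u \<xi> t \<omega> \<le> u)"
      by (rule finite_measure_mono) auto
    finally show ?thesis .
  qed
  have median: "m < u" if "t \<ge> 2" "even t" "is_median M (walk \<alpha> u \<xi> t) m" for t m
  proof (rule ccontr)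
    assume "\<not> m < u"
    \<comment> \<open>A median \<open>m \<ge> u\<close> would put mass at least 1/2 on
      \<open>[m, \<infinity>)\<close>, hence on \<open>[u, \<infinity>)\<close>, against the strict
      bound.\<close>
    then have "\<P>(\<omega> in M. walk \<alpha> u \<xi> t \<omega> \<ge> m) \<le> \<P>(\<omega> in M. walk \<alpha> u \<xi> t \<omega> \<ge> u)"
      by (intro finite_measure_mono) auto
    then show False using ge_even[of t] that by (simp add: is_median_def)
  qed
  show ?thesis
  proof (intro conjI allI impI)
    fix t :: nat assume "t \<ge> 1"
    then show "\<P>(\<omega> in M. walk \<alpha> u \<xi> t \<omega> \<le> u) \<ge> 1 / 2"
      using ge[of t] compl[of t] by linarith
  next
    fix t :: nat assume "t \<ge> 1" "even t"
    then show "\<P>(\<omega> in M. walk \<alpha> u \<xi> t \<omega> \<le> u) > 1 / 2"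
      using ge_even[of t] compl[of t] by linarith
  qed (use median in blast)
qed

end
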